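(* Let $p \in \{2, 3, 5\}$. Then there exists a cubic form $F \in \mathbb{Z}[x_1, \ldots, x_{11}]$ in $11$ variables defining a smooth cubic hypersurface (smooth over $\mathbb{C}$) which contains no line defined over $\mathbb{Q}_p$.
   Context: A hypersurface $F=0$ contains a line defined over $\mathbb{Q}_p$ if there exist $\mathbb{Q}_p$-linearly independent $\mathbf{x}, \mathbf{y} \in \mathbb{Q}_p^{11}$ with $F(\lambda\mathbf{x}+\mu\mathbf{y})=0$ for all $\lambda,\mu \in \mathbb{Q}_p$. *)

theory Defs
  imports
    "HOL-Analysis.Analysis"
    "HOL-Library.Poly_Mapping"
    "Berlekamp_Zassenhaus.Finite_Field"
begin

section \<open>The field of p-adic numbers\<close>

text \<open>
  The prime $p$ is carried by a type argument of class \<^class>\<open>prime_card\<close>, so that the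
  $p$-adic numbers form a type of class \<^class>\<open>field\<close>. The following instances show that the
  primes 2, 3 and 5 do occur.
\<close>

instance Enum.finite_2 :: prime_card
proof
  have "CARD(Enum.finite_2) = 2"
    by (simp add: UNIV_finite_2)
  then show "prime CARD(Enum.finite_2)"
    by simp
qed

instance Enum.finite_3 :: prime_card
proof
  have "CARD(Enum.finite_3) = 3"
    by (simp add: UNIV_finite_3)
  then show "prime CARD(Enum.finite_3)"
    by simp
qed

instance Enum.finite_5 :: prime_card
proof
  have "CARD(Enum.finite_5) = 5"
    by (simp add: UNIV_finite_5)
  then show "prime CARD(Enum.finite_5)"
    by simp
qed

text \<open>The normalised $p$-adic absolute value \<open>p powi (- v x)\<close> of a rational number,
  where \<open>v x\<close> is the multiplicity of $p$ in the numerator minus that in the denominator.\<close>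

definition padic_abs :: "nat \<Rightarrow> rat \<Rightarrow> rat" where
  "padic_abs p x = (if x = 0 then 0 else of_nat p powi
     (int (multiplicity (int p) (snd (quotient_of x)))
      - int (multiplicity (int p) (fst (quotient_of x)))))"

definition padic_cauchy :: "nat \<Rightarrow> (nat \<Rightarrow> rat) \<Rightarrow> bool" where
  "padic_cauchy p X \<longleftrightarrow> (\<forall>e>0. \<exists>N. \<forall>m\<ge>N. \<forall>n\<ge>N. padic_abs p (X m - X n) < e)"

definition padic_null :: "nat \<Rightarrow> (nat \<Rightarrow> rat) \<Rightarrow> bool" where
  "padic_null p X \<longleftrightarrow> (\<forall>e>0. \<exists>N. \<forall>n\<ge>N. padic_abs p (X n) < e)"

lemma padic_abs_0 [simp]: "padic_abs p 0 = 0"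
  by (simp add: padic_abs_def)

context
  fixes p :: nat
  assumes p: "prime p"
begin

lemma padic_abs_divide_int:
  fixes a b :: int
  assumes "a \<noteq> 0" "b \<noteq> 0"
  shows "padic_abs p (of_int a / of_int b)
    = of_nat p powi (int (multiplicity (int p) b) - int (multiplicity (int p) a))"
proof -
  define x :: rat where "x = of_int a / of_int b"
  obtain c d where cd: "quotient_of x = (c, d)"
    by (cases "quotient_of x")
  have d: "d > 0" and x: "x = of_int c / of_int d"
    using quotient_of_denom_pos[OF cd] quotient_of_div[OF cd] by auto
  have "x \<noteq> 0"
    using assms by (simp add: x_def)
  then have c: "c \<noteq> 0"
    using x by auto
  have "(of_int (a * d) :: rat) = of_int (c * b)"
    using x d assms by (simp add: x_def frac_eq_eq)
  then have eq: "a * d = c * b"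
    by (simp only: of_int_eq_iff)
  have pp: "prime_elem (int p)"
    using p by simp
  have "multiplicity (int p) a + multiplicity (int p) d
      = multiplicity (int p) c + multiplicity (int p) b"
    using arg_cong[OF eq, of "multiplicity (int p)"] assms c d
    by (simp add: prime_elem_multiplicity_mult_distrib[OF pp])
  then have "int (multiplicity (int p) d) - int (multiplicity (int p) c)
      = int (multiplicity (int p) b) - int (multiplicity (int p) a)"
    by linarith
  then show ?thesis
    using \<open>x \<noteq> 0\<close> cd unfolding x_def[symmetric] by (simp add: padic_abs_def)
qed

lemma rat_as_fraction:
  fixes x :: rat
  obtains a b :: int where "b \<noteq> 0" "x = of_int a / of_int b"
proof -
  obtain c d where cd: "quotient_of x = (c, d)"
    by (cases "quotient_of x")
  show thesis
    using that[of d c] quotient_of_denom_pos[OF cd] quotient_of_div[OF cd] by auto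
qed

lemma padic_abs_pos: "x \<noteq> 0 \<Longrightarrow> padic_abs p x > 0"
  using p by (simp add: padic_abs_def prime_gt_0_nat)

lemma padic_abs_ge_0: "padic_abs p x \<ge> 0"
  using padic_abs_pos[of x] by (cases "x = 0") auto

lemma padic_abs_mult: "padic_abs p (x * y) = padic_abs p x * padic_abs p y"
proof (cases "x = 0 \<or> y = 0")
  case False
  obtain a b where x: "b \<noteq> 0" "x = of_int a / of_int b" by (rule rat_as_fraction)
  obtain c d where y: "d \<noteq> 0" "y = of_int c / of_int d" by (rule rat_as_fraction)
  have nz: "a \<noteq> 0" "c \<noteq> 0"
    using False x y by auto
  have xy: "x * y = of_int (a * c) / of_int (b * d)"
    by (simp add: x y)
  have pp: "prime_elem (int p)"
    using p by simp
  have p0: "(of_nat p :: rat) \<noteq> 0"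
    using p by auto
  have "padic_abs p (x * y) = of_nat p powi
     ((int (multiplicity (int p) b) - int (multiplicity (int p) a))
      + (int (multiplicity (int p) d) - int (multiplicity (int p) c)))"
    unfolding xy using nz x(1) y(1)
    by (subst padic_abs_divide_int)
      (auto simp: prime_elem_multiplicity_mult_distrib[OF pp] algebra_simps)
  also have "\<dots> = padic_abs p x * padic_abs p y"
    unfolding x(2) y(2) using nz x(1) y(1) p0
    by (simp only: padic_abs_divide_int power_int_add not_False_eq_True simp_thms)
  finally show ?thesis .
qed auto

lemma padic_abs_minus: "padic_abs p (- x) = padic_abs p x"
proof -
  have "padic_abs p (- 1) = 1"
    using padic_abs_divide_int[of "- 1" 1] by (simp add: multiplicity_unit_right)
  then show ?thesis
    using padic_abs_mult[of "- 1" x] by simp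
qed

lemma padic_abs_add: "padic_abs p (x + y) \<le> max (padic_abs p x) (padic_abs p y)"
proof (cases "x = 0 \<or> y = 0 \<or> x + y = 0")
  case True
  then show ?thesis
    using padic_abs_ge_0[of x] padic_abs_ge_0[of y] by (auto simp: le_max_iff_disj)
next
  case False
  obtain a b where x: "b \<noteq> 0" "x = of_int a / of_int b" by (rule rat_as_fraction)
  obtain c d where y: "d \<noteq> 0" "y = of_int c / of_int d" by (rule rat_as_fraction)
  let ?v = "\<lambda>k. multiplicity (int p) k"
  have x': "x = of_int (a * d) / of_int (b * d)" and y': "y = of_int (c * b) / of_int (b * d)"
    and xy: "x + y = of_int (a * d + c * b) / of_int (b * d)"
    using x y by (auto simp: field_simps)
  have nz: "a * d \<noteq> 0" "c * b \<noteq> 0" "b * d \<noteq> 0"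
    using False x y by auto
  have s: "a * d + c * b \<noteq> 0"
    using False xy by (metis div_0 of_int_0)
  have nu: "\<not> is_unit (int p)"
    using prime_gt_1_nat[OF p] by (simp add: zdvd1_eq)
  define m where "m = min (?v (a * d)) (?v (c * b))"
  have "int p ^ m dvd a * d + c * b"
    by (intro dvd_add multiplicity_dvd') (auto simp: m_def)
  then have le: "m \<le> ?v (a * d + c * b)"
    using s nu by (intro multiplicity_geI) auto
  have p1: "(1::rat) \<le> of_nat p"
    using prime_gt_1_nat[OF p] by simp
  have ax: "padic_abs p x = of_nat p powi (int (?v (b * d)) - int (?v (a * d)))"
    unfolding x' by (rule padic_abs_divide_int) (use nz in auto)
  have ay: "padic_abs p y = of_nat p powi (int (?v (b * d)) - int (?v (c * b)))"
    unfolding y' by (rule padic_abs_divide_int) (use nz in auto)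
  have "padic_abs p (x + y) = of_nat p powi (int (?v (b * d)) - int (?v (a * d + c * b)))"
    unfolding xy by (rule padic_abs_divide_int) (use nz s in auto)
  also have "\<dots> \<le> of_nat p powi (int (?v (b * d)) - int m)"
    using le p1 by (intro power_int_increasing) auto
  also have "\<dots> \<le> max (padic_abs p x) (padic_abs p y)"
    unfolding ax ay m_def by (auto simp: min_def)
  finally show ?thesis .
qed

lemma padic_abs_diff: "padic_abs p (x - y) \<le> max (padic_abs p x) (padic_abs p y)"
  using padic_abs_add[of x "- y"] by (simp add: padic_abs_minus)

lemma padic_abs_1: "padic_abs p 1 = 1"
  by (simp add: padic_abs_def)

lemma padic_abs_inverse: "padic_abs p (inverse x) = inverse (padic_abs p x)"
proof (cases "x = 0")
  case False
  then have "padic_abs p x * padic_abs p (inverse x) = 1"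
    by (simp add: padic_abs_mult[symmetric] padic_abs_1)
  then show ?thesis
    by (simp add: inverse_unique)
qed auto

lemma padic_null_0: "padic_null p (\<lambda>n. 0)"
  by (simp add: padic_null_def)

lemma padic_null_add:
  assumes "padic_null p X" "padic_null p Y"
  shows "padic_null p (\<lambda>n. X n + Y n)"
  unfolding padic_null_def
proof (intro allI impI)
  fix e :: rat assume "e > 0"
  then obtain M N where "\<forall>n\<ge>M. padic_abs p (X n) < e" "\<forall>n\<ge>N. padic_abs p (Y n) < e"
    using assms unfolding padic_null_def by meson
  then have "padic_abs p (X n + Y n) < e" if "n \<ge> max M N" for n
    using padic_abs_add[of "X n" "Y n"] that by (auto intro: le_less_trans)
  then show "\<exists>N. \<forall>n\<ge>N. padic_abs p (X n + Y n) < e" by blast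
qed

lemma padic_null_minus: "padic_null p X \<Longrightarrow> padic_null p (\<lambda>n. - X n)"
  by (simp add: padic_null_def padic_abs_minus)

lemma padic_null_diff:
  "padic_null p X \<Longrightarrow> padic_null p Y \<Longrightarrow> padic_null p (\<lambda>n. X n - Y n)"
  using padic_null_add[of X "\<lambda>n. - Y n"] padic_null_minus[of Y] by simp

lemma padic_cauchy_const: "padic_cauchy p (\<lambda>n. x)"
  by (simp add: padic_cauchy_def)

lemma padic_cauchy_add:
  assumes "padic_cauchy p X" "padic_cauchy p Y"
  shows "padic_cauchy p (\<lambda>n. X n + Y n)"
  unfolding padic_cauchy_def
proof (intro allI impI)
  fix e :: rat assume "e > 0"
  then obtain M N where MN: "\<forall>m\<ge>M. \<forall>n\<ge>M. padic_abs p (X m - X n) < e"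
      "\<forall>m\<ge>N. \<forall>n\<ge>N. padic_abs p (Y m - Y n) < e"
    using assms unfolding padic_cauchy_def by meson
  have "padic_abs p (X m + Y m - (X n + Y n)) < e" if "m \<ge> max M N" "n \<ge> max M N" for m n
    using padic_abs_add[of "X m - X n" "Y m - Y n"] MN that
    by (auto simp: add_diff_add intro: le_less_trans)
  then show "\<exists>N. \<forall>m\<ge>N. \<forall>n\<ge>N. padic_abs p (X m + Y m - (X n + Y n)) < e" by blast
qed

lemma padic_cauchy_minus: "padic_cauchy p X \<Longrightarrow> padic_cauchy p (\<lambda>n. - X n)"
  using padic_abs_minus[of "X m - X n" for m n] by (simp add: padic_cauchy_def)

lemma padic_cauchy_bounded:
  assumes "padic_cauchy p X"
  obtains B where "B > 0" "\<And>n. padic_abs p (X n) < B"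
proof -
  obtain N where N: "\<forall>m\<ge>N. \<forall>n\<ge>N. padic_abs p (X m - X n) < 1"
    using assms unfolding padic_cauchy_def by (meson zero_less_one)
  define C where "C = Max ((\<lambda>n. padic_abs p (X n)) ` {..N})"
  have C: "padic_abs p (X n) \<le> C" if "n \<le> N" for n
    unfolding C_def using that by (intro Max_ge) auto
  define B where "B = C + 1"
  have le: "padic_abs p (X n) < B" if "n \<le> N" for n
    using C[OF that] by (simp add: B_def)
  have B1: "B \<ge> 1"
    using C[of N] padic_abs_ge_0[of "X N"] by (simp add: B_def)
  have "padic_abs p (X n) < B" for n
  proof (cases "n \<le> N")
    case False
    then have "padic_abs p (X n - X N) < 1"
      using N by simp
    then show ?thesis
      using padic_abs_add[of "X n - X N" "X N"] le[of N] B1 by auto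
  qed (rule le)
  then show thesis
    using B1 by (intro that[of B]) auto
qed

lemma padic_null_mult_cauchy:
  assumes "padic_null p X" "padic_cauchy p Y"
  shows "padic_null p (\<lambda>n. X n * Y n)"
  unfolding padic_null_def
proof (intro allI impI)
  fix e :: rat assume e: "e > 0"
  obtain B where B: "B > 0" "\<And>n. padic_abs p (Y n) < B"
    using padic_cauchy_bounded[OF assms(2)] by blast
  obtain N where N: "\<forall>n\<ge>N. padic_abs p (X n) < e / B"
    using assms(1) e B(1) unfolding padic_null_def by (meson divide_pos_pos)
  have "padic_abs p (X n * Y n) < e" if "n \<ge> N" for n
    using mult_strict_mono[of "padic_abs p (X n)" "e / B" "padic_abs p (Y n)" B] N that B e
    by (simp add: padic_abs_mult padic_abs_ge_0)
  then show "\<exists>N. \<forall>n\<ge>N. padic_abs p (X n * Y n) < e" by blast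
qed

lemma padic_cauchy_mult:
  assumes "padic_cauchy p X" "padic_cauchy p Y"
  shows "padic_cauchy p (\<lambda>n. X n * Y n)"
  unfolding padic_cauchy_def
proof (intro allI impI)
  fix e :: rat assume e: "e > 0"
  obtain B where B: "B > 0" "\<And>n. padic_abs p (X n) < B"
    using padic_cauchy_bounded[OF assms(1)] by blast
  obtain C where C: "C > 0" "\<And>n. padic_abs p (Y n) < C"
    using padic_cauchy_bounded[OF assms(2)] by blast
  obtain M where M: "\<forall>m\<ge>M. \<forall>n\<ge>M. padic_abs p (X m - X n) < e / C"
    using assms(1) e C(1) unfolding padic_cauchy_def by (meson divide_pos_pos)
  obtain N where N: "\<forall>m\<ge>N. \<forall>n\<ge>N. padic_abs p (Y m - Y n) < e / B"
    using assms(2) e B(1) unfolding padic_cauchy_def by (meson divide_pos_pos)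
  have "padic_abs p (X m * Y m - X n * Y n) < e" if "m \<ge> max M N" "n \<ge> max M N" for m n
  proof -
    have 1: "padic_abs p (X m * (Y m - Y n)) < e"
      using mult_strict_mono[of "padic_abs p (X m)" B "padic_abs p (Y m - Y n)" "e / B"]
        N that B e by (simp add: padic_abs_mult padic_abs_ge_0)
    have 2: "padic_abs p ((X m - X n) * Y n) < e"
      using mult_strict_mono[of "padic_abs p (X m - X n)" "e / C" "padic_abs p (Y n)" C]
        M that C e by (simp add: padic_abs_mult padic_abs_ge_0)
    have "X m * Y m - X n * Y n = X m * (Y m - Y n) + (X m - X n) * Y n"
      by (simp add: algebra_simps)
    then show ?thesis
      using 1 2 padic_abs_add[of "X m * (Y m - Y n)" "(X m - X n) * Y n"] by simp
  qed
  then show "\<exists>N. \<forall>m\<ge>N. \<forall>n\<ge>N. padic_abs p (X m * Y m - X n * Y n) < e" by blast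
qed

lemma padic_cauchy_not_null:
  assumes "padic_cauchy p X" "\<not> padic_null p X"
  obtains b N where "b > 0" "\<And>n. n \<ge> N \<Longrightarrow> b \<le> padic_abs p (X n)"
proof -
  obtain e where e: "e > 0" "\<And>N. \<exists>n\<ge>N. e \<le> padic_abs p (X n)"
    using assms(2) unfolding padic_null_def by (meson not_less)
  obtain N where N: "\<forall>m\<ge>N. \<forall>n\<ge>N. padic_abs p (X m - X n) < e"
    using assms(1) e(1) unfolding padic_cauchy_def by meson
  obtain m where m: "m \<ge> N" "e \<le> padic_abs p (X m)"
    using e(2) by blast
  have "e \<le> padic_abs p (X n)" if "n \<ge> N" for n
  proof -
    have "padic_abs p (X m - X n) < e"
      using N m that by simp
    then show ?thesis
      using padic_abs_add[of "X m - X n" "X n"] m(2) by simp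
  qed
  then show thesis
    using that e(1) by blast
qed

lemma padic_cauchy_inverse:
  assumes "padic_cauchy p X" "\<not> padic_null p X"
  shows "padic_cauchy p (\<lambda>n. inverse (X n))"
  unfolding padic_cauchy_def
proof (intro allI impI)
  fix e :: rat assume e: "e > 0"
  obtain b M where b: "b > 0" "\<And>n. n \<ge> M \<Longrightarrow> b \<le> padic_abs p (X n)"
    using padic_cauchy_not_null[OF assms] by blast
  obtain N where N: "\<forall>m\<ge>N. \<forall>n\<ge>N. padic_abs p (X m - X n) < e * (b * b)"
    using assms(1) e b(1) unfolding padic_cauchy_def by (meson mult_pos_pos)
  have "padic_abs p (inverse (X m) - inverse (X n)) < e" if "m \<ge> max M N" "n \<ge> max M N" for m n
  proof -
    have bm: "b \<le> padic_abs p (X m)" and bn: "b \<le> padic_abs p (X n)"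
      using b that by auto
    then have nz: "X m \<noteq> 0" "X n \<noteq> 0"
      using b(1) by auto
    have eq: "(inverse (X m) - inverse (X n)) * (X m * X n) = - (X m - X n)"
      using nz by (simp add: field_simps)
    have "padic_abs p (inverse (X m) - inverse (X n)) * (b * b)
        \<le> padic_abs p (inverse (X m) - inverse (X n)) * (padic_abs p (X m) * padic_abs p (X n))"
      using bm bn b(1) by (intro mult_left_mono mult_mono padic_abs_ge_0) auto
    also have "\<dots> = padic_abs p (X m - X n)"
      using arg_cong[OF eq, of "padic_abs p"] by (simp only: padic_abs_mult padic_abs_minus)
    also have "\<dots> < e * (b * b)"
      using N that by simp
    finally show ?thesis
      using b(1) by simp
  qed
  then show "\<exists>N. \<forall>m\<ge>N. \<forall>n\<ge>N. padic_abs p (inverse (X m) - inverse (X n)) < e" by blast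
qed

lemma padic_null_inverse:
  assumes "padic_cauchy p X" "\<not> padic_null p X"
  shows "padic_null p (\<lambda>n. inverse (X n) * X n - 1)"
proof -
  obtain b M where b: "b > 0" "\<And>n. n \<ge> M \<Longrightarrow> b \<le> padic_abs p (X n)"
    using padic_cauchy_not_null[OF assms] by blast
  have "inverse (X n) * X n - 1 = 0" if "n \<ge> M" for n
  proof -
    have "X n \<noteq> 0"
      using b(1) b(2)[OF that] by auto
    then show ?thesis by simp
  qed
  then show ?thesis
    unfolding padic_null_def by (metis padic_abs_0)
qed

end

text \<open>The $p$-adic numbers are the completion of the rationals with respect to
  \<^const>\<open>padic_abs\<close>: the ring of Cauchy sequences modulo the ideal of null sequences.\<close>

typedef 'p padic_seq = "{X. padic_cauchy CARD('p::prime_card) X}"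
  morphisms seq_of Padic_seq
  using padic_cauchy_const[OF prime_card] by blast

setup_lifting type_definition_padic_seq

instantiation padic_seq :: (prime_card) comm_ring_1
begin

lift_definition zero_padic_seq :: "'a padic_seq" is "\<lambda>n. 0"
  by (rule padic_cauchy_const[OF prime_card])

lift_definition one_padic_seq :: "'a padic_seq" is "\<lambda>n. 1"
  by (rule padic_cauchy_const[OF prime_card])

lift_definition plus_padic_seq :: "'a padic_seq \<Rightarrow> 'a padic_seq \<Rightarrow> 'a padic_seq"
  is "\<lambda>X Y n. X n + Y n"
  by (rule padic_cauchy_add[OF prime_card])

lift_definition uminus_padic_seq :: "'a padic_seq \<Rightarrow> 'a padic_seq" is "\<lambda>X n. - X n"
  by (rule padic_cauchy_minus[OF prime_card])

lift_definition minus_padic_seq :: "'a padic_seq \<Rightarrow> 'a padic_seq \<Rightarrow> 'a padic_seq"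
  is "\<lambda>X Y n. X n - Y n"
  unfolding diff_conv_add_uminus
  by (intro padic_cauchy_add[OF prime_card] padic_cauchy_minus[OF prime_card])

lift_definition times_padic_seq :: "'a padic_seq \<Rightarrow> 'a padic_seq \<Rightarrow> 'a padic_seq"
  is "\<lambda>X Y n. X n * Y n"
  by (rule padic_cauchy_mult[OF prime_card])

instance
  by standard (transfer; simp add: fun_eq_iff algebra_simps)+

end

lift_definition padic_seq_null :: "'p::prime_card padic_seq \<Rightarrow> bool" is "padic_null CARD('p)" .

lift_definition padic_seq_inverse :: "'p::prime_card padic_seq \<Rightarrow> 'p padic_seq"
  is "\<lambda>X. if padic_null CARD('p) X then (\<lambda>n. 0) else (\<lambda>n. inverse (X n))"
  by (simp add: padic_cauchy_const padic_cauchy_inverse prime_card)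

lemma padic_seq_null_0: "padic_seq_null 0"
  by transfer (rule padic_null_0[OF prime_card])

lemma padic_seq_null_add: "padic_seq_null X \<Longrightarrow> padic_seq_null Y \<Longrightarrow> padic_seq_null (X + Y)"
  by transfer (rule padic_null_add[OF prime_card])

lemma padic_seq_null_diff: "padic_seq_null X \<Longrightarrow> padic_seq_null Y \<Longrightarrow> padic_seq_null (X - Y)"
  by transfer (rule padic_null_diff[OF prime_card])

lemma padic_seq_null_mult: "padic_seq_null X \<Longrightarrow> padic_seq_null (X * Y)"
  by transfer (rule padic_null_mult_cauchy[OF prime_card])

lemma padic_seq_null_1: "\<not> padic_seq_null 1"
  by transfer (use zero_less_one in \<open>force simp: padic_null_def padic_abs_1 prime_card\<close>)

lemma padic_seq_inverse_null: "padic_seq_null X \<Longrightarrow> padic_seq_inverse X = 0"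
  by transfer simp

lemma padic_seq_inverse: "\<not> padic_seq_null X \<Longrightarrow> padic_seq_null (padic_seq_inverse X * X - 1)"
  by transfer (simp add: padic_null_inverse prime_card)

definition padic_rel :: "'p::prime_card padic_seq \<Rightarrow> 'p padic_seq \<Rightarrow> bool" where
  "padic_rel X Y \<longleftrightarrow> padic_seq_null (X - Y)"

lemma equivp_padic_rel: "equivp padic_rel"
proof (rule equivpI)
  show "reflp padic_rel"
    by (simp add: reflp_def padic_rel_def padic_seq_null_0)
  show "symp padic_rel"
    using padic_seq_null_diff[OF padic_seq_null_0] by (fastforce simp: symp_def padic_rel_def)
  show "transp padic_rel"
    using padic_seq_null_add by (fastforce simp: transp_def padic_rel_def)
qed

quotient_type (overloaded) 'p padic = "'p::prime_card padic_seq" / padic_rel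
  by (rule equivp_padic_rel)

instantiation padic :: (prime_card) field
begin

lift_definition zero_padic :: "'a padic" is 0 .

lift_definition one_padic :: "'a padic" is 1 .

lift_definition plus_padic :: "'a padic \<Rightarrow> 'a padic \<Rightarrow> 'a padic" is "(+)"
  unfolding padic_rel_def add_diff_add by (rule padic_seq_null_add)

lift_definition uminus_padic :: "'a padic \<Rightarrow> 'a padic" is uminus
  unfolding padic_rel_def using padic_seq_null_diff[OF padic_seq_null_0] by fastforce

lift_definition minus_padic :: "'a padic \<Rightarrow> 'a padic \<Rightarrow> 'a padic" is "(-)"
proof -
  fix X X' Y Y' :: "'a padic_seq"
  assume "padic_rel X X'" "padic_rel Y Y'"
  moreover have "X - Y - (X' - Y') = (X - X') - (Y - Y')"
    by simp
  ultimately show "padic_rel (X - Y) (X' - Y')"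
    unfolding padic_rel_def by (simp only: padic_seq_null_diff)
qed

lift_definition times_padic :: "'a padic \<Rightarrow> 'a padic \<Rightarrow> 'a padic" is "(*)"
proof -
  fix X X' Y Y' :: "'a padic_seq"
  assume "padic_rel X X'" "padic_rel Y Y'"
  moreover have "X * Y - X' * Y' = (X - X') * Y + (Y - Y') * X'"
    by (simp add: algebra_simps)
  ultimately show "padic_rel (X * Y) (X' * Y')"
    unfolding padic_rel_def by (simp only: padic_seq_null_add padic_seq_null_mult)
qed

lift_definition inverse_padic :: "'a padic \<Rightarrow> 'a padic" is padic_seq_inverse
proof -
  fix X Y :: "'a padic_seq"
  assume "padic_rel X Y"
  then have XY: "padic_seq_null (X - Y)"
    by (simp add: padic_rel_def)
  have iff: "padic_seq_null X \<longleftrightarrow> padic_seq_null Y"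
    using padic_seq_null_diff[OF _ XY, of X] padic_seq_null_add[OF XY, of Y] by auto
  show "padic_rel (padic_seq_inverse X) (padic_seq_inverse Y)"
  proof (cases "padic_seq_null X")
    case True
    then show ?thesis
      using iff by (simp add: padic_rel_def padic_seq_inverse_null padic_seq_null_0)
  next
    case False
    let ?U = "padic_seq_inverse X" and ?V = "padic_seq_inverse Y"
    have "?U - ?V = (?U * X - 1) * ?V - (?V * Y - 1) * ?U - (X - Y) * (?U * ?V)"
      by (simp add: algebra_simps)
    moreover have "padic_seq_null (?U * X - 1)" "padic_seq_null (?V * Y - 1)"
      using False iff by (simp_all add: padic_seq_inverse)
    then have "padic_seq_null ((?U * X - 1) * ?V - (?V * Y - 1) * ?U - (X - Y) * (?U * ?V))"
      using XY by (simp only: padic_seq_null_diff padic_seq_null_mult)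
    ultimately show ?thesis
      by (simp add: padic_rel_def)
  qed
qed

definition divide_padic :: "'a padic \<Rightarrow> 'a padic \<Rightarrow> 'a padic" where
  "divide_padic x y = x * inverse y"

instance
proof
  fix a b c :: "'a padic"
  note rel = padic_rel_def padic_seq_null_0 algebra_simps
  show "a * b * c = a * (b * c)"
    by transfer (simp add: rel)
  show "a * b = b * a"
    by transfer (simp add: rel)
  show "1 * a = a"
    by transfer (simp add: rel)
  show "a + b + c = a + (b + c)"
    by transfer (simp add: rel)
  show "a + b = b + a"
    by transfer (simp add: rel)
  show "0 + a = a"
    by transfer (simp add: rel)
  show "- a + a = 0"
    by transfer (simp add: rel)
  show "a - b = a + - b"
    by transfer (simp add: rel)
  show "(a + b) * c = a * c + b * c"
    by transfer (simp add: rel)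
  show "(0::'a padic) \<noteq> 1"
  proof transfer
    show "\<not> padic_rel 0 (1 :: 'a padic_seq)"
      using padic_seq_null_diff[OF padic_seq_null_0, of "- 1 :: 'a padic_seq"] padic_seq_null_1
      by (auto simp: padic_rel_def)
  qed
  show "a \<noteq> 0 \<Longrightarrow> inverse a * a = 1"
    by transfer (simp add: padic_rel_def padic_seq_inverse)
  show "a div b = a * inverse b"
    by (rule divide_padic_def)
  show "inverse (0::'a padic) = 0"
    by transfer (simp add: padic_rel_def padic_seq_inverse_null padic_seq_null_0)
qed

end

section \<open>Forms, smoothness and lines\<close>

text \<open>Polynomials with coefficients in \<open>'a\<close> in variables indexed by \<open>'n\<close>:
  a finitely supported map from exponent vectors to coefficients.\<close>

type_synonym ('n, 'a) mpoly = "('n \<Rightarrow>\<^sub>0 nat) \<Rightarrow>\<^sub>0 'a"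

definition form :: "nat \<Rightarrow> ('n::finite, 'a::zero) mpoly \<Rightarrow> bool" where
  "form d F \<longleftrightarrow> (\<forall>m \<in> Poly_Mapping.keys F. (\<Sum>i\<in>UNIV. Poly_Mapping.lookup m i) = d)"

definition eval_int_mpoly :: "('n::finite, int) mpoly \<Rightarrow> 'k::comm_ring_1 ^ 'n \<Rightarrow> 'k" where
  "eval_int_mpoly F v = (\<Sum>m\<in>Poly_Mapping.keys F.
     of_int (Poly_Mapping.lookup F m) * (\<Prod>i\<in>UNIV. (v $ i) ^ Poly_Mapping.lookup m i))"

text \<open>The truncated exponent in \<open>m - single i 1\<close> is harmless: if \<open>i\<close> does not occur in \<open>m\<close>,
  the coefficient vanishes.\<close>

definition mpoly_partial :: "'n \<Rightarrow> ('n::finite, 'a::comm_semiring_1) mpoly \<Rightarrow> ('n, 'a) mpoly" where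
  "mpoly_partial i F = (\<Sum>m\<in>Poly_Mapping.keys F.
     Poly_Mapping.single (m - Poly_Mapping.single i 1)
       (of_nat (Poly_Mapping.lookup m i) * Poly_Mapping.lookup F m))"

text \<open>The projective hypersurface $F = 0$ over the complex numbers has no singular point.
  In particular this excludes $F = 0$.\<close>

definition smooth_over_complex :: "('n::finite, int) mpoly \<Rightarrow> bool" where
  "smooth_over_complex F \<longleftrightarrow>
     \<not> (\<exists>z :: complex ^ 'n. z \<noteq> 0 \<and> eval_int_mpoly F z = 0
          \<and> (\<forall>i. eval_int_mpoly (mpoly_partial i F) z = 0))"

definition contains_line_over :: "'k::field itself \<Rightarrow> ('n::finite, int) mpoly \<Rightarrow> bool" where
  "contains_line_over _ F \<longleftrightarrow>
     (\<exists>x y :: 'k ^ 'n. (\<forall>a b. a *s x + b *s y = 0 \<longrightarrow> a = 0 \<and> b = 0)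
        \<and> (\<forall>a b. eval_int_mpoly F (a *s x + b *s y) = 0))"

end

theory Submission
  imports Defs
begin

text \<open>
  Let \<open>N\<close> be a ternary cubic form without nontrivial zeros modulo \<open>p\<close>. Consider
  \[ F = x_0 x_4^2 + N(x_1, x_2, x_3) + p N(x_5, x_6, x_7) + p^2 N(x_8, x_9, x_{10}) + p^3 K \sum_i x_i^3 . \]
  If \<open>K\<close> is large, the diagonal part dominates and \<open>F\<close> is smooth over the complex numbers. A primitive
  \<open>p\<close>-adic integral zero of \<open>F\<close> has a unit among \<open>x\<^sub>0, \<dots>, x\<^sub>4\<close>, since otherwise \<open>F = 0\<close>
  forces \<open>p\<close> to divide \<open>x\<^sub>5, x\<^sub>6, x\<^sub>7\<close> and then \<open>x\<^sub>8, x\<^sub>9, x\<^sub>1\<^sub>0\<close>. A line in \<open>F = 0\<close> contains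
  primitive vectors \<open>v\<close> with \<open>v\<^sub>4 = 0\<close> and \<open>w\<close> with \<open>w\<^sub>0 = 0\<close>. For both, \<open>N(x\<^sub>1, x\<^sub>2, x\<^sub>3)\<close> vanishes
  modulo \<open>p\<close>, so \<open>p\<close> divides \<open>x\<^sub>1, x\<^sub>2, x\<^sub>3\<close> and \<open>v\<^sub>0\<close>, \<open>w\<^sub>4\<close> are units. But then \<open>F(v + w)\<close> is
  congruent to the unit \<open>v\<^sub>0 w\<^sub>4\<^sup>2\<close>.
\<close>

section \<open>The ring of p-adic integers\<close>

text \<open>Only a tail is constrained, so null sequences qualify and the property can pass to the
  quotient \<open>padic\<close>.\<close>

lift_definition padic_seq_integral :: "'p::prime_card padic_seq \<Rightarrow> bool"
  is "\<lambda>X. \<exists>N. \<forall>n\<ge>N. padic_abs CARD('p) (X n) \<le> 1" .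

lemma padic_seq_integral_add:
  "padic_seq_integral X \<Longrightarrow> padic_seq_integral Y \<Longrightarrow> padic_seq_integral (X + Y)"
proof transfer
  fix X Y :: "nat \<Rightarrow> rat"
  assume "\<exists>N. \<forall>n\<ge>N. padic_abs CARD('a) (X n) \<le> 1" "\<exists>N. \<forall>n\<ge>N. padic_abs CARD('a) (Y n) \<le> 1"
  then obtain M N where "\<forall>n\<ge>M. padic_abs CARD('a) (X n) \<le> 1" "\<forall>n\<ge>N. padic_abs CARD('a) (Y n) \<le> 1"
    by blast
  then have "padic_abs CARD('a) (X n + Y n) \<le> 1" if "n \<ge> max M N" for n
    using padic_abs_add[OF prime_card[where 'a = 'a], of "X n" "Y n"] that
    by (auto intro: order_trans)
  then show "\<exists>N. \<forall>n\<ge>N. padic_abs CARD('a) (X n + Y n) \<le> 1"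
    by blast
qed

lemma padic_seq_integral_mult:
  "padic_seq_integral X \<Longrightarrow> padic_seq_integral Y \<Longrightarrow> padic_seq_integral (X * Y)"
proof transfer
  fix X Y :: "nat \<Rightarrow> rat"
  assume "\<exists>N. \<forall>n\<ge>N. padic_abs CARD('a) (X n) \<le> 1" "\<exists>N. \<forall>n\<ge>N. padic_abs CARD('a) (Y n) \<le> 1"
  then obtain M N where "\<forall>n\<ge>M. padic_abs CARD('a) (X n) \<le> 1" "\<forall>n\<ge>N. padic_abs CARD('a) (Y n) \<le> 1"
    by blast
  then have "padic_abs CARD('a) (X n * Y n) \<le> 1" if "n \<ge> max M N" for n
    using that by (simp add: padic_abs_mult[OF prime_card] padic_abs_ge_0[OF prime_card] mult_le_one)
  then show "\<exists>N. \<forall>n\<ge>N. padic_abs CARD('a) (X n * Y n) \<le> 1"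
    by blast
qed

lemma padic_seq_integral_null: "padic_seq_null X \<Longrightarrow> padic_seq_integral X"
  by transfer (unfold padic_null_def, meson less_imp_le zero_less_one)

lemma padic_seq_integral_1: "padic_seq_integral 1"
  by transfer (simp add: padic_abs_1[OF prime_card])

lemma padic_seq_integral_minus_1: "padic_seq_integral (- 1)"
  by transfer (simp add: padic_abs_1[OF prime_card] padic_abs_minus[OF prime_card])

text \<open>The valuation ring property at the level of sequences. Past an index where terms differ
  by less than 1 in absolute value, one term of absolute value above 1 forces absolute value at
  least 1 on all the others, by the ultrametric inequality.\<close>

lemma padic_seq_integral_or_inverse:
  "padic_seq_integral X \<or> padic_seq_integral (padic_seq_inverse X)"
proof transfer
  fix X :: "nat \<Rightarrow> rat"
  note pc = prime_card[where 'a = 'a]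
  let ?abs = "padic_abs CARD('a)"
  assume X: "padic_cauchy CARD('a) X"
  have "\<exists>N. \<forall>n\<ge>N. ?abs (inverse (X n)) \<le> 1" if nX: "\<not> (\<exists>N. \<forall>n\<ge>N. ?abs (X n) \<le> 1)"
  proof -
    obtain N where N: "\<forall>m\<ge>N. \<forall>n\<ge>N. ?abs (X m - X n) < 1"
      using X unfolding padic_cauchy_def by (meson zero_less_one)
    obtain m where m: "m \<ge> N" "?abs (X m) > 1"
      using nX by (meson not_le)
    have "?abs (inverse (X n)) \<le> 1" if "n \<ge> N" for n
    proof -
      have "?abs (X m) \<le> max (?abs (X m - X n)) (?abs (X n))"
        using padic_abs_add[OF pc, of "X m - X n" "X n"] by simp
      moreover have "?abs (X m - X n) < 1"
        using N m(1) that by simp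
      ultimately have "1 \<le> ?abs (X n)"
        using m(2) by (auto simp: max_def split: if_splits)
      then show ?thesis
        by (simp add: padic_abs_inverse[OF pc] inverse_le_1_iff)
    qed
    then show ?thesis
      by blast
  qed
  then show "(\<exists>N. \<forall>n\<ge>N. ?abs (X n) \<le> 1) \<or>
    (\<exists>N. \<forall>n\<ge>N. ?abs ((if padic_null CARD('a) X then \<lambda>n. 0 else (\<lambda>n. inverse (X n))) n) \<le> 1)"
    by auto
qed

section \<open>Integers as representatives modulo p\<close>

lemma seq_of_of_nat: "seq_of (of_nat k :: 'p::prime_card padic_seq) n = of_nat k"
  by (induction k) (simp_all add: zero_padic_seq.rep_eq one_padic_seq.rep_eq plus_padic_seq.rep_eq)

lemma seq_of_of_int: "seq_of (of_int k :: 'p::prime_card padic_seq) n = of_int k"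
  by (cases k rule: int_diff_cases)
    (simp add: minus_padic_seq.rep_eq seq_of_of_nat)

lemma padic_abs_of_prime:
  "padic_abs CARD('p::prime_card) (of_nat CARD('p)) = 1 / of_nat CARD('p)"
proof -
  have "multiplicity (int CARD('p)) (int CARD('p)) = 1"
    using prime_card[where 'a = 'p] by (intro multiplicity_self) (auto simp: zdvd1_eq dest: prime_gt_1_nat)
  then show ?thesis
    using padic_abs_divide_int[OF prime_card[where 'a = 'p], of "int CARD('p)" 1]
    by (simp add: power_int_minus divide_inverse)
qed

lemma padic_abs_of_int_le_1: "padic_abs CARD('p::prime_card) (of_int k) \<le> 1"
proof (cases "k = 0")
  case False
  have "of_nat CARD('p) powi (- int m) \<le> (1 :: rat)" for m
    using prime_gt_1_nat[OF prime_card[where 'a = 'p]]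
    by (simp add: power_int_minus inverse_le_1_iff)
  then show ?thesis
    using padic_abs_divide_int[OF prime_card[where 'a = 'p], of k 1] False by simp
qed auto

lemma padic_abs_of_int_dvd:
  assumes "int CARD('p::prime_card) dvd k"
  shows "padic_abs CARD('p) (of_int k) \<le> 1 / of_nat CARD('p)"
proof -
  obtain j where "k = int CARD('p) * j"
    using assms by blast
  then have "padic_abs CARD('p) (of_int k)
      = padic_abs CARD('p) (of_int j) * (1 / of_nat CARD('p))"
    by (simp add: padic_abs_mult[OF prime_card] padic_abs_of_prime)
  also have "\<dots> \<le> 1 * (1 / of_nat CARD('p))"
    by (intro mult_right_mono padic_abs_of_int_le_1) auto
  finally show ?thesis
    by simp
qed

text \<open>The denominator b is prime to p, hence has an inverse c modulo p. With numerator a, the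
  integer a c works, because (x - a c) b = a (1 - b c) and b has absolute value 1.\<close>

lemma rat_approx_int:
  fixes x :: rat
  assumes "padic_abs CARD('p::prime_card) x \<le> 1"
  obtains k :: int where "padic_abs CARD('p) (x - of_int k) \<le> 1 / of_nat CARD('p)"
proof (cases "x = 0")
  case True
  then show thesis
    using that[of 0] by simp
next
  case False
  let ?p = "int CARD('p)"
  note pc = prime_card[where 'a = 'p]
  obtain a b where ab: "quotient_of x = (a, b)"
    by (cases "quotient_of x")
  have b: "b > 0" and x: "x = of_int a / of_int b" and cop: "coprime a b"
    using quotient_of_denom_pos[OF ab] quotient_of_div[OF ab] quotient_of_coprime[OF ab] by auto
  have a: "a \<noteq> 0"
    using False x by auto
  have p1: "?p > 1"
    using prime_gt_1_nat[OF pc] by simp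
  \<comment> \<open>Otherwise p does not divide the numerator, and the absolute value of x is a
    positive power of p.\<close>
  have nb: "\<not> ?p dvd b"
  proof
    assume pb: "?p dvd b"
    then have "\<not> ?p dvd a"
      using cop p1 by (metis coprime_common_divisor zdvd1_eq abs_of_nonneg less_irrefl of_nat_0_le_iff)
    then have "multiplicity ?p a = 0"
      by (simp add: not_dvd_imp_multiplicity_0)
    moreover have "multiplicity ?p b > 0"
      using pb b p1 by (subst multiplicity_gt_zero_iff) auto
    ultimately have "padic_abs CARD('p) x = of_nat CARD('p) ^ multiplicity ?p b"
      using padic_abs_divide_int[OF pc a, of b] b x by simp
    moreover have "(1::rat) < of_nat CARD('p) ^ multiplicity ?p b"
      using p1 \<open>multiplicity ?p b > 0\<close> by (intro one_less_power) auto
    ultimately show False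
      using assms by simp
  qed
  then have "coprime b ?p"
    using pc by (metis coprime_commute prime_imp_coprime prime_int_nat_transfer nat_int of_nat_0_le_iff)
  then obtain c where c: "[b * c = 1] (mod ?p)"
    using cong_solve_coprime_int by blast
  then have d: "?p dvd a * (1 - b * c)"
    by (metis cong_iff_dvd_diff cong_sym dvd_mult)
  have "multiplicity ?p b = 0"
    using nb by (simp add: not_dvd_imp_multiplicity_0)
  then have "padic_abs CARD('p) (of_int b) = 1"
    using padic_abs_divide_int[OF pc, of b 1] b by simp
  moreover have "(x - of_int (a * c)) * of_int b = of_int (a * (1 - b * c))"
    using b by (simp add: x field_simps)
  ultimately have "padic_abs CARD('p) (x - of_int (a * c)) = padic_abs CARD('p) (of_int (a * (1 - b * c)))"
    by (metis mult.right_neutral padic_abs_mult[OF pc])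
  then show thesis
    using that[of "a * c"] padic_abs_of_int_dvd[OF d] by simp
qed

lemma padic_seq_prime_not_null: "\<not> padic_seq_null (of_nat CARD('p) :: 'p::prime_card padic_seq)"
proof -
  have "\<not> padic_abs CARD('p) (of_nat CARD('p)) < 1 / of_nat CARD('p)" "(1 :: rat) / of_nat CARD('p) > 0"
    by (simp_all add: padic_abs_of_prime)
  then show ?thesis
    unfolding padic_seq_null.rep_eq padic_null_def seq_of_of_nat by blast
qed

text \<open>From some index L on, all terms agree with the L-th one up to 1/p, so an integer
  approximating that single term approximates the whole tail. Congruence modulo p is phrased as
  integrality after division by p.\<close>

lemma padic_seq_approx_int:
  fixes X :: "'p::prime_card padic_seq"
  assumes "padic_seq_integral X"
  shows "\<exists>k. padic_seq_integral ((X - of_int k) * padic_seq_inverse (of_nat CARD('p)))"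
proof -
  let ?p = "of_nat CARD('p) :: rat"
  let ?abs = "padic_abs CARD('p)"
  note pc = prime_card[where 'a = 'p]
  have p0: "?p > 0"
    using prime_gt_0_nat[OF pc] by simp
  have C: "padic_cauchy CARD('p) (seq_of X)"
    using seq_of[of X] by simp
  then obtain M where M: "\<forall>m\<ge>M. \<forall>n\<ge>M. ?abs (seq_of X m - seq_of X n) < 1 / ?p"
    using p0 unfolding padic_cauchy_def by (meson zero_less_divide_1_iff)
  obtain N where N: "\<forall>n\<ge>N. ?abs (seq_of X n) \<le> 1"
    using assms unfolding padic_seq_integral.rep_eq by blast
  define L where "L = max M N"
  obtain k where k: "?abs (seq_of X L - of_int k) \<le> 1 / ?p"
    using N rat_approx_int[where 'p = 'p] unfolding L_def by (metis max.cobounded2)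
  \<comment> \<open>This rules out the default value 0 of \<open>padic_seq_inverse\<close>.\<close>
  have nn: "\<not> padic_null CARD('p) (\<lambda>n. ?p)"
    using padic_seq_prime_not_null[where 'p = 'p]
    by (simp add: padic_seq_null.rep_eq seq_of_of_nat[abs_def])
  have "?abs (seq_of ((X - of_int k) * padic_seq_inverse (of_nat CARD('p))) n) \<le> 1"
    if "n \<ge> L" for n
  proof -
    have "?abs (seq_of X n - of_int k) \<le>
        max (?abs (seq_of X n - seq_of X L)) (?abs (seq_of X L - of_int k))"
      using padic_abs_add[OF pc, of "seq_of X n - seq_of X L" "seq_of X L - of_int k"] by simp
    also have "\<dots> \<le> 1 / ?p"
      using k M that by (auto simp: L_def intro: less_imp_le)
    finally have "?abs (seq_of X n - of_int k) * ?p \<le> 1"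
      using p0 by (simp add: field_simps)
    moreover have "seq_of (of_nat CARD('p) :: 'p padic_seq) = (\<lambda>n. ?p)"
      by (rule ext) (rule seq_of_of_nat)
    ultimately show ?thesis
      using nn by (simp add: times_padic_seq.rep_eq minus_padic_seq.rep_eq seq_of_of_int
          padic_seq_inverse.rep_eq padic_abs_mult[OF pc] padic_abs_inverse[OF pc] padic_abs_of_prime)
  qed
  then show ?thesis
    unfolding padic_seq_integral.rep_eq by blast
qed

text \<open>If p X were 1 up to a null sequence, 1 would be a difference of two rationals of
  absolute value below 1.\<close>

lemma padic_seq_prime_not_unit:
  fixes X :: "'p::prime_card padic_seq"
  assumes "padic_seq_integral X"
  shows "\<not> padic_seq_null (of_nat CARD('p) * X - 1)"
proof
  let ?p = "of_nat CARD('p) :: rat"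
  let ?abs = "padic_abs CARD('p)"
  note pc = prime_card[where 'a = 'p]
  assume "padic_seq_null (of_nat CARD('p) * X - 1)"
  then obtain M where M: "\<forall>n\<ge>M. ?abs (?p * seq_of X n - 1) < 1"
    unfolding padic_seq_null.rep_eq padic_null_def
    by (auto simp: minus_padic_seq.rep_eq times_padic_seq.rep_eq one_padic_seq.rep_eq seq_of_of_nat
        dest: spec[of _ 1])
  obtain N where N: "\<forall>n\<ge>N. ?abs (seq_of X n) \<le> 1"
    using assms unfolding padic_seq_integral.rep_eq by blast
  let ?x = "seq_of X (max M N)"
  have p1: "?p > 1"
    using prime_gt_1_nat[OF pc] by simp
  have "?abs (?p * ?x) \<le> 1 / ?p"
    using N p1 by (simp add: padic_abs_mult[OF pc] padic_abs_of_prime divide_right_mono)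
  also have "\<dots> < 1"
    using p1 by simp
  finally have "?abs (?p * ?x - (?p * ?x - 1)) < 1"
    using M padic_abs_diff[OF pc, of "?p * ?x" "?p * ?x - 1"] by (simp add: le_less_trans)
  then show False
    by (simp add: padic_abs_1[OF pc])
qed

section \<open>Integrality of p-adic numbers\<close>

lift_definition padic_integral :: "'p::prime_card padic \<Rightarrow> bool" is padic_seq_integral
proof -
  \<comment> \<open>One implication suffices, since \<open>padic_rel\<close> is symmetric.\<close>
  have *: "padic_seq_integral Y" if "padic_seq_integral X" "padic_seq_null (X - Y)"
    for X Y :: "'p padic_seq"
  proof -
    have "padic_seq_integral (- 1 * (X - Y))"
      using that by (intro padic_seq_integral_mult padic_seq_integral_minus_1 padic_seq_integral_null)
    then show ?thesis
      using padic_seq_integral_add[OF that(1), of "- 1 * (X - Y)"] by simp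
  qed
  fix X Y :: "'p padic_seq"
  assume "padic_rel X Y"
  moreover from this have "padic_rel Y X"
    using equivp_padic_rel by (metis equivp_symp)
  ultimately show "padic_seq_integral X = padic_seq_integral Y"
    using * unfolding padic_rel_def by blast
qed

lemma padic_integral_add: "padic_integral x \<Longrightarrow> padic_integral y \<Longrightarrow> padic_integral (x + y)"
  by transfer (rule padic_seq_integral_add)

lemma padic_integral_mult: "padic_integral x \<Longrightarrow> padic_integral y \<Longrightarrow> padic_integral (x * y)"
  by transfer (rule padic_seq_integral_mult)

lemma padic_integral_1: "padic_integral 1"
  by transfer (rule padic_seq_integral_1)

lemma padic_integral_0: "padic_integral 0"
  by transfer (rule padic_seq_integral_null[OF padic_seq_null_0])

lemma padic_integral_minus: "padic_integral x \<Longrightarrow> padic_integral (- x)"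
proof -
  have "padic_integral (- 1 :: 'a padic)"
    by transfer (rule padic_seq_integral_minus_1)
  then show "padic_integral x \<Longrightarrow> padic_integral (- x)"
    using padic_integral_mult[of "- 1" x] by simp
qed

lemma padic_integral_diff: "padic_integral x \<Longrightarrow> padic_integral y \<Longrightarrow> padic_integral (x - y)"
  using padic_integral_add[of x "- y"] by (simp add: padic_integral_minus)

lemma padic_integral_of_nat: "padic_integral (of_nat k)"
  by (induction k) (auto intro: padic_integral_add padic_integral_0 padic_integral_1)

lemma padic_integral_of_int: "padic_integral (of_int k)"
  by (cases k rule: int_diff_cases) (simp add: padic_integral_diff padic_integral_of_nat)

lemma padic_integral_numeral: "padic_integral (numeral k)"
  using padic_integral_of_nat[of "numeral k"] by simp

lemma padic_integral_power: "padic_integral x \<Longrightarrow> padic_integral (x ^ k)"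
  by (induction k) (auto intro: padic_integral_mult padic_integral_1)

lemma padic_integral_sum: "(\<And>i. i \<in> A \<Longrightarrow> padic_integral (f i)) \<Longrightarrow> padic_integral (sum f A)"
  by (induction A rule: infinite_finite_induct) (auto intro: padic_integral_add padic_integral_0)

lemmas padic_integral_intros =
  padic_integral_add padic_integral_diff padic_integral_minus padic_integral_mult
  padic_integral_power padic_integral_sum padic_integral_0 padic_integral_1
  padic_integral_numeral padic_integral_of_nat padic_integral_of_int

lemma padic_integral_or_inverse: "padic_integral x \<or> padic_integral (inverse x)"
  by transfer (rule padic_seq_integral_or_inverse)

text \<open>Gives casts the shape that \<open>transfer\<close> can carry down to sequences.\<close>

lemma of_nat_eq_abs_padic: "of_nat k = abs_padic (of_nat k)"
  by (induction k) (simp_all add: zero_padic_def one_padic_def plus_padic.abs_eq)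

lemma of_int_eq_abs_padic: "of_int k = abs_padic (of_int k)"
  by (cases k rule: int_diff_cases) (simp add: of_nat_eq_abs_padic minus_padic.abs_eq)

lemma padic_prime_nonzero [simp]: "of_nat CARD('p) \<noteq> (0 :: 'p::prime_card padic)"
  unfolding of_nat_eq_abs_padic
  by transfer (simp add: padic_rel_def padic_seq_prime_not_null)

lemma padic_prime_not_unit:
  "padic_integral (x :: 'p::prime_card padic) \<Longrightarrow> of_nat CARD('p) * x \<noteq> 1"
  unfolding of_nat_eq_abs_padic
  by transfer (simp add: padic_rel_def padic_seq_prime_not_unit)

text \<open>This is the maximal ideal p Z_p of the p-adic integers; dividing by p in the field
  avoids an existential quantifier.\<close>

definition padic_small :: "'p::prime_card padic \<Rightarrow> bool" where
  "padic_small x \<longleftrightarrow> padic_integral (x / of_nat CARD('p))"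

lemma padic_small_prime_mult [simp]:
  "padic_small (of_nat CARD('p) * x) \<longleftrightarrow> padic_integral (x :: 'p::prime_card padic)"
  by (simp add: padic_small_def)

lemma padic_smallE:
  fixes x :: "'p::prime_card padic"
  assumes "padic_small x"
  obtains y where "padic_integral y" "x = of_nat CARD('p) * y"
  using assms that[of "x / of_nat CARD('p)"] by (simp add: padic_small_def)

lemma padic_small_0 [simp]: "padic_small 0"
  by (simp add: padic_small_def padic_integral_0)

lemma padic_small_1: "\<not> padic_small 1"
  by (metis padic_prime_not_unit padic_smallE)

lemma padic_small_add: "padic_small x \<Longrightarrow> padic_small y \<Longrightarrow> padic_small (x + y)"
  by (simp add: padic_small_def add_divide_distrib padic_integral_add)

lemma padic_small_diff: "padic_small x \<Longrightarrow> padic_small y \<Longrightarrow> padic_small (x - y)"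
  by (simp add: padic_small_def diff_divide_distrib padic_integral_diff)

lemma padic_small_mult: "padic_integral x \<Longrightarrow> padic_small y \<Longrightarrow> padic_small (x * y)"
  using padic_integral_mult[of x "y / of_nat CARD('a)"] by (simp add: padic_small_def)

text \<open>Integers represent all classes of Z_p modulo p, which reduces congruences between p-adic
  integers to divisibility in the integers.\<close>

lemma padic_approx_int:
  fixes x :: "'p::prime_card padic"
  assumes "padic_integral x"
  obtains k where "padic_small (x - of_int k)"
proof -
  have "\<exists>k. padic_integral ((x - of_int k) * inverse (of_nat CARD('p)))"
    using assms unfolding of_nat_eq_abs_padic of_int_eq_abs_padic
    by transfer (rule padic_seq_approx_int)
  then show thesis
    using that by (auto simp: divide_inverse padic_small_def)
qed

lemma padic_small_of_int:
  "padic_small (of_int k :: 'p::prime_card padic) \<longleftrightarrow> int CARD('p) dvd k"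
proof
  assume "int CARD('p) dvd k"
  then show "padic_small (of_int k :: 'p padic)"
    by (auto simp: padic_integral_of_int)
next
  assume k: "padic_small (of_int k :: 'p padic)"
  show "int CARD('p) dvd k"
  proof (rule ccontr)
    assume "\<not> int CARD('p) dvd k"
    then have "coprime (int CARD('p)) k"
      using prime_card[where 'a = 'p] by (intro prime_imp_coprime) simp_all
    \<comment> \<open>With this Bezout identity, smallness of k would make 1 small.\<close>
    then obtain u v where "u * int CARD('p) + v * k = 1"
      using bezout_int[of "int CARD('p)" k] by auto
    then have "(1 :: 'p padic) = of_int (u * int CARD('p) + v * k)"
      by simp
    also have "\<dots> = of_nat CARD('p) * of_int u + of_int v * of_int k"
      by simp
    also have "padic_small \<dots>"
      using k by (intro padic_small_add padic_small_mult[OF padic_integral_of_int])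
        (simp_all add: padic_integral_of_int)
    finally show False
      using padic_small_1 by blast
  qed
qed

section \<open>Congruences modulo p, written as \<open>padic_small\<close> of a difference\<close>

lemma padic_cong_add:
  "padic_small (a - a') \<Longrightarrow> padic_small (b - b') \<Longrightarrow> padic_small ((a + b) - (a' + b'))"
  using padic_small_add[of "a - a'" "b - b'"] by (simp add: algebra_simps)

lemma padic_cong_diff:
  "padic_small (a - a') \<Longrightarrow> padic_small (b - b') \<Longrightarrow> padic_small ((a - b) - (a' - b'))"
  using padic_small_diff[of "a - a'" "b - b'"] by (simp add: algebra_simps)

lemma padic_cong_mult:
  assumes "padic_integral b" "padic_integral a'" "padic_small (a - a')" "padic_small (b - b')"
  shows "padic_small (a * b - a' * b')"
  using padic_small_add[OF padic_small_mult[OF assms(1,3)] padic_small_mult[OF assms(2,4)]]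
  by (simp add: algebra_simps)

lemma padic_cong_power:
  assumes "padic_integral a" "padic_integral a'" "padic_small (a - a')"
  shows "padic_small (a ^ n - a' ^ n)"
  by (induction n) (use assms in \<open>auto intro!: padic_cong_mult padic_integral_power\<close>)

lemma padic_small_iff_int:
  assumes "padic_small (x - of_int k :: 'p::prime_card padic)"
  shows "padic_small x \<longleftrightarrow> int CARD('p) dvd k"
  using padic_small_add[OF assms, of "of_int k"] padic_small_diff[OF _ assms, of x]
  by (auto simp: padic_small_of_int)

text \<open>The ideal is prime: with integer representatives this is Euclid's lemma for p.\<close>

lemma padic_small_multD:
  fixes x y :: "'p::prime_card padic"
  assumes "padic_integral x" "padic_integral y" "padic_small (x * y)"
  shows "padic_small x \<or> padic_small y"
proof -
  obtain k l where k: "padic_small (x - of_int k)" and l: "padic_small (y - of_int l)"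
    using padic_approx_int assms(1,2) by metis
  have "padic_small (x * y - of_int (k * l))"
    using padic_cong_mult[OF assms(2) padic_integral_of_int k l] by simp
  then have "int CARD('p) dvd k * l"
    using assms(3) padic_small_iff_int by blast
  then show ?thesis
    using prime_card[where 'a = 'p] k l by (simp add: prime_dvd_mult_iff padic_small_iff_int)
qed

text \<open>Selects an element of largest absolute value, comparing elements by integrality of
  quotients. If x / m is not integral, then m / x is, and x replaces m as the dominant
  element.\<close>

lemma padic_exists_dominant:
  assumes "finite A" "A \<noteq> {}" "0 \<notin> A"
  shows "\<exists>m\<in>A. \<forall>x\<in>A. padic_integral (x / m)"
  using assms
proof (induction rule: finite_ne_induct)
  case (singleton x)
  then show ?case
    by (simp add: padic_integral_1)
next
  case (insert x A)
  then obtain m where m: "m \<in> A" "\<forall>y\<in>A. padic_integral (y / m)"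
    by auto
  then have nz: "m \<noteq> 0" "x \<noteq> 0"
    using insert.prems by auto
  show ?case
  proof (cases "padic_integral (x / m)")
    case True
    then show ?thesis
      using m by blast
  next
    case False
    then have "padic_integral (m / x)"
      using padic_integral_or_inverse[of "x / m"] by (simp add: inverse_eq_divide)
    then have "padic_integral (y / x)" if "y \<in> A" for y
      using padic_integral_mult[of "y / m" "m / x"] m that nz by simp
    then show ?thesis
      using nz by (auto simp: padic_integral_1)
  qed
qed

text \<open>Dividing by a coordinate of largest absolute value makes all coordinates integral and
  that one equal to 1.\<close>

lemma padic_primitive_multiple:
  fixes z :: "'p::prime_card padic ^ 'n"
  assumes "z \<noteq> 0"
  obtains c where "c \<noteq> 0" "\<And>i. padic_integral ((c *s z) $ i)" "\<exists>i. \<not> padic_small ((c *s z) $ i)"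
proof -
  define A where "A = (\<lambda>i. z $ i) ` {i. z $ i \<noteq> 0}"
  obtain j where "z $ j \<noteq> 0"
    using assms by (metis vec_eq_iff zero_index)
  then have "finite A" "A \<noteq> {}" "0 \<notin> A"
    unfolding A_def by (simp, blast, force)
  from padic_exists_dominant[OF this] obtain m
    where m: "m \<in> A" "\<forall>x\<in>A. padic_integral (x / m)"
    by (rule bexE)
  then obtain k where k: "m = z $ k" "z $ k \<noteq> 0"
    unfolding A_def by blast
  show thesis
  proof (rule that[of "inverse m"])
    show "inverse m \<noteq> 0"
      using k by simp
    show "padic_integral ((inverse m *s z) $ i)" for i
    proof (cases "z $ i = 0")
      case True
      then show ?thesis
        by (simp add: padic_integral_0)
    next
      case False
      then have "padic_integral (z $ i / m)"
        using m(2) unfolding A_def by blast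
      then show ?thesis
        by (simp add: divide_inverse mult.commute)
    qed
    have "(inverse m *s z) $ k = 1"
      using k by simp
    then show "\<exists>i. \<not> padic_small ((inverse m *s z) $ i)"
      using padic_small_1 by metis
  qed
qed

section \<open>A norm form without zeros modulo 2, 3 and 5\<close>

text \<open>The norm of \<open>a + b \<theta> + c \<theta>\<^sup>2\<close>, where \<open>\<theta>\<^sup>3 = \<theta> + 7\<close>. The polynomial
  \<open>t\<^sup>3 - t - 7\<close> is irreducible modulo each of 2, 3 and 5.\<close>

definition cubic_norm :: "'a::comm_ring_1 \<Rightarrow> 'a \<Rightarrow> 'a \<Rightarrow> 'a" where
  "cubic_norm a b c = a ^ 3 + 7 * b ^ 3 + 49 * c ^ 3 + 2 * a ^ 2 * c + a * c ^ 2 - a * b ^ 2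
     - 7 * b * c ^ 2 - 21 * a * b * c"

lemma cubic_norm_scale: "cubic_norm (t * a) (t * b) (t * c) = t ^ 3 * cubic_norm a b c"
  by (simp add: cubic_norm_def algebra_simps power2_eq_square power3_eq_cube)

lemma of_int_cubic_norm:
  "of_int (cubic_norm a b c) = cubic_norm (of_int a) (of_int b) (of_int c)"
  by (simp add: cubic_norm_def)

lemma padic_integral_cubic_norm:
  "padic_integral a \<Longrightarrow> padic_integral b \<Longrightarrow> padic_integral c \<Longrightarrow> padic_integral (cubic_norm a b c)"
  unfolding cubic_norm_def by (intro padic_integral_intros)

lemma padic_small_cubic_norm:
  fixes a b c :: "'p::prime_card padic"
  assumes "padic_small a" "padic_small b" "padic_small c"
  shows "padic_small (cubic_norm a b c)"
proof -
  obtain a' b' c' where "padic_integral a'" "a = of_nat CARD('p) * a'"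
      "padic_integral b'" "b = of_nat CARD('p) * b'" "padic_integral c'" "c = of_nat CARD('p) * c'"
    using assms by (metis padic_smallE)
  then show ?thesis
    by (simp add: cubic_norm_scale power3_eq_cube mult.assoc padic_integral_intros
        padic_integral_cubic_norm)
qed

text \<open>The norm from the field with p^3 elements vanishes only at 0. The finitely many residue
  triples are checked by evaluation.\<close>

lemma cubic_norm_anisotropic_mod:
  "\<forall>a\<in>{0, 1::int}. \<forall>b\<in>{0, 1}. \<forall>c\<in>{0, 1}.
     cubic_norm a b c mod 2 = 0 \<longrightarrow> a = 0 \<and> b = 0 \<and> c = 0"
  "\<forall>a\<in>{0, 1, 2::int}. \<forall>b\<in>{0, 1, 2}. \<forall>c\<in>{0, 1, 2}.
     cubic_norm a b c mod 3 = 0 \<longrightarrow> a = 0 \<and> b = 0 \<and> c = 0"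
  "\<forall>a\<in>{0, 1, 2, 3, 4::int}. \<forall>b\<in>{0, 1, 2, 3, 4}. \<forall>c\<in>{0, 1, 2, 3, 4}.
     cubic_norm a b c mod 5 = 0 \<longrightarrow> a = 0 \<and> b = 0 \<and> c = 0"
  by (simp_all add: cubic_norm_def)

lemma cubic_norm_mod: "cubic_norm (a mod n) (b mod n) (c mod n) mod n = cubic_norm a b c mod (n :: int)"
  unfolding cong_def[symmetric] cubic_norm_def
  by (intro cong_add cong_diff cong_mult cong_pow cong_refl) (simp_all add: cong_def)

lemma cubic_norm_dvdD:
  fixes a b c :: int
  assumes "p \<in> {2, 3, 5}" "p dvd cubic_norm a b c"
  shows "p dvd a \<and> p dvd b \<and> p dvd c"
proof -
  have "x mod 2 \<in> {0, 1}" "x mod 3 \<in> {0, 1, 2}" "x mod 5 \<in> {0, 1, 2, 3, 4}" for x :: int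
    by (simp; presburger)+
  then show ?thesis
    using assms cubic_norm_mod[of a p b c] cubic_norm_anisotropic_mod
    unfolding dvd_eq_mod_eq_0 by (elim insertE emptyE) metis+
qed

text \<open>Anisotropy modulo p lifts to p-adic integers by replacing the arguments with congruent
  integers.\<close>

lemma padic_small_cubic_normD:
  fixes a b c :: "'p::prime_card padic"
  assumes p: "CARD('p) \<in> {2, 3, 5}"
    and int: "padic_integral a" "padic_integral b" "padic_integral c"
    and N: "padic_small (cubic_norm a b c)"
  shows "padic_small a \<and> padic_small b \<and> padic_small c"
proof -
  obtain k l m where klm: "padic_small (a - of_int k)" "padic_small (b - of_int l)"
      "padic_small (c - of_int m)"
    using padic_approx_int int by metis
  \<comment> \<open>Reflexivity, which settles the constant coefficients in the congruence
    below.\<close>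
  have cong: "padic_small (x - x)" for x :: "'p padic"
    by simp
  have "padic_small (cubic_norm a b c - of_int (cubic_norm k l m))"
    unfolding of_int_cubic_norm unfolding cubic_norm_def
    by (intro padic_cong_add padic_cong_diff padic_cong_mult padic_cong_power cong klm int
        padic_integral_intros)
  then have "int CARD('p) dvd cubic_norm k l m"
    using N padic_small_iff_int by blast
  moreover have "int CARD('p) \<in> {2, 3, 5}"
    using p by auto
  ultimately show ?thesis
    using cubic_norm_dvdD klm padic_small_iff_int by blast
qed

section \<open>Cubic forms built from monomials\<close>

text \<open>Cancellation can make the support of F + G smaller than the union of the supports; a
  common superset lets all three sums run over the same index set.\<close>

lemma eval_int_mpoly_superset:
  assumes "finite A" "Poly_Mapping.keys F \<subseteq> A"
  shows "eval_int_mpoly F v = (\<Sum>m\<in>A. of_int (Poly_Mapping.lookup F m) *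
    (\<Prod>i\<in>UNIV. (v $ i) ^ Poly_Mapping.lookup m i))"
  unfolding eval_int_mpoly_def
  by (intro sum.mono_neutral_left assms) (simp add: in_keys_iff)

lemma eval_int_mpoly_add: "eval_int_mpoly (F + G) v = eval_int_mpoly F v + eval_int_mpoly G v"
proof -
  let ?A = "Poly_Mapping.keys F \<union> Poly_Mapping.keys G"
  have "finite ?A" "Poly_Mapping.keys F \<subseteq> ?A" "Poly_Mapping.keys G \<subseteq> ?A"
      "Poly_Mapping.keys (F + G) \<subseteq> ?A"
    using Poly_Mapping.keys_add[of F G] by auto
  then show ?thesis
    by (simp add: eval_int_mpoly_superset[of ?A] lookup_add distrib_right sum.distrib)
qed

lemma eval_int_mpoly_0: "eval_int_mpoly 0 v = 0"
  by (simp add: eval_int_mpoly_def)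

lemma eval_int_mpoly_sum: "eval_int_mpoly (sum f A) v = (\<Sum>x\<in>A. eval_int_mpoly (f x) v)"
  by (induction A rule: infinite_finite_induct)
    (simp_all add: eval_int_mpoly_0 eval_int_mpoly_add)

lemma eval_int_mpoly_single:
  "eval_int_mpoly (Poly_Mapping.single m c) v = of_int c * (\<Prod>i\<in>UNIV. (v $ i) ^ Poly_Mapping.lookup m i)"
  by (subst eval_int_mpoly_superset[of "{m}"]) (auto simp: lookup_single)

lemma mpoly_partial_superset:
  assumes "finite A" "Poly_Mapping.keys F \<subseteq> A"
  shows "mpoly_partial i F = (\<Sum>m\<in>A. Poly_Mapping.single (m - Poly_Mapping.single i 1)
    (of_nat (Poly_Mapping.lookup m i) * Poly_Mapping.lookup F m))"
  unfolding mpoly_partial_def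
  by (intro sum.mono_neutral_left assms) (simp add: in_keys_iff)

lemma mpoly_partial_add:
  "mpoly_partial i (F + G) = mpoly_partial i F + mpoly_partial i G"
proof -
  let ?A = "Poly_Mapping.keys F \<union> Poly_Mapping.keys G"
  have "finite ?A" "Poly_Mapping.keys F \<subseteq> ?A" "Poly_Mapping.keys G \<subseteq> ?A"
      "Poly_Mapping.keys (F + G) \<subseteq> ?A"
    using Poly_Mapping.keys_add[of F G] by auto
  then show ?thesis
    by (simp add: mpoly_partial_superset[of ?A] lookup_add distrib_left single_add sum.distrib)
qed

lemma mpoly_partial_sum: "mpoly_partial i (sum f A) = (\<Sum>x\<in>A. mpoly_partial i (f x))"
  by (induction A rule: infinite_finite_induct)
    (simp_all add: mpoly_partial_add mpoly_partial_def[of _ 0])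

lemma mpoly_partial_single:
  "mpoly_partial i (Poly_Mapping.single m c) = Poly_Mapping.single (m - Poly_Mapping.single i 1)
    (of_nat (Poly_Mapping.lookup m i) * c)"
  by (subst mpoly_partial_superset[of "{m}"]) (auto simp: lookup_single)

lemma form_add: "form d F \<Longrightarrow> form d G \<Longrightarrow> form d (F + G)"
  using Poly_Mapping.keys_add[of F G] unfolding form_def by blast

lemma form_sum: "(\<And>x. x \<in> A \<Longrightarrow> form d (f x)) \<Longrightarrow> form d (sum f A)"
  by (induction A rule: infinite_finite_induct) (auto simp: form_add form_def[of _ 0])

lemma form_single:
  "(\<Sum>i\<in>UNIV. Poly_Mapping.lookup m i) = d \<Longrightarrow> form d (Poly_Mapping.single m c)"
  by (simp add: form_def)

lemma form_partial:
  assumes "form (Suc d) F"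
  shows "form d (mpoly_partial i F)"
  unfolding mpoly_partial_def
proof (rule form_sum)
  fix m assume "m \<in> Poly_Mapping.keys F"
  then have deg: "(\<Sum>j\<in>UNIV. Poly_Mapping.lookup m j) = Suc d"
    using assms by (simp add: form_def)
  show "form d (Poly_Mapping.single (m - Poly_Mapping.single i 1)
      (of_nat (Poly_Mapping.lookup m i) * Poly_Mapping.lookup F m))"
  \<comment> \<open>A zero exponent makes the coefficient zero, and the zero polynomial is a form of
    every degree. Otherwise the truncated subtraction is exact and lowers the degree by one.\<close>
  proof (cases "Poly_Mapping.lookup m i = 0")
    case True
    then show ?thesis
      by (simp add: form_def)
  next
    case False
    have "(\<Sum>j\<in>UNIV. Poly_Mapping.lookup (m - Poly_Mapping.single i 1) j)
        = (\<Sum>j\<in>UNIV. Poly_Mapping.lookup m j) - (\<Sum>j\<in>UNIV. Poly_Mapping.lookup (Poly_Mapping.single i 1) j)"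
      using False by (subst sum_subtractf_nat[symmetric]) (auto simp: lookup_single lookup_minus when_def)
    then show ?thesis
      using deg by (intro form_single) (simp add: lookup_single when_def)
  qed
qed

text \<open>The indices may coincide, so cubes and products such as x_i^2 x_k are covered as
  well.\<close>

definition cubic_mono :: "int \<Rightarrow> 'n \<Rightarrow> 'n \<Rightarrow> 'n \<Rightarrow> ('n::finite, int) mpoly" where
  "cubic_mono c i j k = Poly_Mapping.single
     (Poly_Mapping.single i 1 + Poly_Mapping.single j 1 + Poly_Mapping.single k 1) c"

lemma form_cubic_mono: "form 3 (cubic_mono c i j k)"
  unfolding cubic_mono_def
  by (rule form_single) (simp add: lookup_add lookup_single when_def sum.distrib)

lemma eval_cubic_mono: "eval_int_mpoly (cubic_mono c i j k) v = of_int c * (v $ i * v $ j * v $ k)"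
proof -
  have "(\<Prod>l\<in>UNIV. (v $ l) ^ Poly_Mapping.lookup (Poly_Mapping.single a (1::nat)) l) = v $ a" for a
    by (simp add: lookup_single when_def if_distrib[of "\<lambda>e. (v $ _) ^ e"] cong: if_cong)
  then show ?thesis
    by (simp add: cubic_mono_def eval_int_mpoly_single lookup_add power_add prod.distrib)
qed

text \<open>Cubes are the only monomials whose derivatives are computed exactly; those of the rest
  of the form are merely bounded.\<close>

lemma eval_partial_cube:
  fixes i :: "'n::finite"
  shows "eval_int_mpoly (mpoly_partial i (cubic_mono c j j j)) v
    = (if i = j then 3 * of_int c * (v $ i) ^ 2 else 0)"
proof (cases "i = j")
  case True
  have "Poly_Mapping.single i 1 + Poly_Mapping.single i 1 + Poly_Mapping.single i 1
      - Poly_Mapping.single i 1 = (Poly_Mapping.single i 2 :: 'n \<Rightarrow>\<^sub>0 nat)"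
    by (rule poly_mapping_eqI) (simp add: lookup_minus lookup_add lookup_single when_def)
  moreover have "(\<Prod>l\<in>UNIV. (v $ l) ^ Poly_Mapping.lookup (Poly_Mapping.single i 2) l) = (v $ i) ^ 2"
    by (simp add: lookup_single when_def if_distrib[of "\<lambda>e. (v $ _) ^ e"] cong: if_cong)
  ultimately show ?thesis
    using True by (simp add: cubic_mono_def mpoly_partial_single eval_int_mpoly_single lookup_add)
next
  case False
  then show ?thesis
    by (simp add: cubic_mono_def mpoly_partial_single lookup_add lookup_single eval_int_mpoly_0)
qed

section \<open>Diagonal cubics and smoothness over the complex numbers\<close>

definition fermat_cubic :: "int \<Rightarrow> ('n::finite, int) mpoly" where
  "fermat_cubic c = (\<Sum>j\<in>UNIV. cubic_mono c j j j)"

lemma form_fermat_cubic: "form 3 (fermat_cubic c)"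
  unfolding fermat_cubic_def by (intro form_sum form_cubic_mono)

lemma eval_fermat_cubic: "eval_int_mpoly (fermat_cubic c) v = of_int c * (\<Sum>j\<in>UNIV. (v $ j) ^ 3)"
  by (simp add: fermat_cubic_def eval_int_mpoly_sum eval_cubic_mono sum_distrib_left power3_eq_cube)

lemma eval_partial_fermat_cubic:
  "eval_int_mpoly (mpoly_partial i (fermat_cubic c)) v = 3 * of_int c * (v $ i) ^ 2"
  by (simp add: fermat_cubic_def mpoly_partial_sum eval_int_mpoly_sum eval_partial_cube)

text \<open>Triangle inequality: each monomial of degree d has norm at most B^d.\<close>

lemma norm_eval_form_le:
  fixes v :: "complex ^ 'n::finite"
  assumes "form d F" "\<And>i. norm (v $ i) \<le> B"
  shows "norm (eval_int_mpoly F v)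
    \<le> of_int (\<Sum>m\<in>Poly_Mapping.keys F. \<bar>Poly_Mapping.lookup F m\<bar>) * B ^ d"
proof -
  have "norm (\<Prod>i\<in>UNIV. (v $ i) ^ Poly_Mapping.lookup m i) \<le> B ^ d"
    if m: "m \<in> Poly_Mapping.keys F" for m
  proof -
    have "norm (\<Prod>i\<in>UNIV. (v $ i) ^ Poly_Mapping.lookup m i) \<le> (\<Prod>i\<in>UNIV. B ^ Poly_Mapping.lookup m i)"
      unfolding prod_norm[symmetric] norm_power
      by (intro prod_mono conjI power_mono assms) auto
    also have "\<dots> = B ^ d"
      using assms(1) m by (simp add: form_def flip: power_sum)
    finally show ?thesis .
  qed
  then have "norm (eval_int_mpoly F v)
      \<le> (\<Sum>m\<in>Poly_Mapping.keys F. of_int \<bar>Poly_Mapping.lookup F m\<bar> * B ^ d)"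
    unfolding eval_int_mpoly_def
    by (intro sum_norm_le) (simp add: norm_mult mult_left_mono)
  then show ?thesis
    by (simp add: sum_distrib_right)
qed

text \<open>Diagonal dominance: at a coordinate \<open>i\<close> where \<open>\<bar>z\<^sub>i\<bar>\<close> is maximal, the term \<open>3 K z\<^sub>i\<^sup>2\<close>
  of the \<open>i\<close>-th partial derivative cannot be cancelled.\<close>

lemma smooth_add_fermat_cubic:
  fixes G :: "('n::finite, int) mpoly"
  assumes "form 3 G"
  obtains K0 where "\<And>K. K \<ge> K0 \<Longrightarrow> smooth_over_complex (G + fermat_cubic K)"
proof -
  define C where "C i = (\<Sum>m\<in>Poly_Mapping.keys (mpoly_partial i G).
    \<bar>Poly_Mapping.lookup (mpoly_partial i G) m\<bar>)" for i
  have C0: "C i \<ge> 0" for i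
    unfolding C_def by (intro sum_nonneg) auto
  show thesis
  \<comment> \<open>The coefficient sums \<open>C i\<close> are nonnegative, so this bound makes K
    positive and larger than each of them.\<close>
  proof (rule that[of "(\<Sum>i\<in>UNIV. C i) + 1"])
    fix K assume K: "(\<Sum>i\<in>UNIV. C i) + 1 \<le> K"
    have CK: "C i < K" "0 < K" for i
      using K member_le_sum[of i UNIV C] C0 sum_nonneg[of UNIV C] by auto
    show "smooth_over_complex (G + fermat_cubic K)"
      unfolding smooth_over_complex_def
    proof (intro notI, elim exE conjE)
      fix z :: "complex ^ 'n"
      assume z: "z \<noteq> 0" and part: "\<forall>i. eval_int_mpoly (mpoly_partial i (G + fermat_cubic K)) z = 0"
      have "Max (range (\<lambda>j. norm (z $ j))) \<in> range (\<lambda>j. norm (z $ j))"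
        by (intro Max_in) auto
      then obtain i where "Max (range (\<lambda>j. norm (z $ j))) = norm (z $ i)"
        by (rule imageE)
      then have i: "norm (z $ j) \<le> norm (z $ i)" for j
        by (metis Max_ge finite_class.finite_UNIV finite_imageI rangeI)
      have pos: "norm (z $ i) > 0"
        using z i by (auto simp: vec_eq_iff)
      have "3 * of_int K * (z $ i) ^ 2 = - eval_int_mpoly (mpoly_partial i G) z"
        using spec[OF part, of i]
        by (simp add: mpoly_partial_add eval_int_mpoly_add eval_partial_fermat_cubic
            eq_neg_iff_add_eq_0 add.commute)
      then have "norm (3 * of_int K * (z $ i) ^ 2) = norm (eval_int_mpoly (mpoly_partial i G) z)"
        by (simp only: norm_minus_cancel)
      also have "\<dots> \<le> of_int (C i) * norm (z $ i) ^ 2"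
        unfolding C_def by (intro norm_eval_form_le form_partial i) (use assms in \<open>simp add: numeral_3_eq_3\<close>)
      also have "\<dots> < of_int (3 * K) * norm (z $ i) ^ 2"
        using pos CK(1)[of i] CK(2) by (intro mult_strict_right_mono) (simp_all del: of_int_mult)
      also have "\<dots> = norm (3 * of_int K * (z $ i) ^ 2)"
        using CK(2) by (simp add: norm_mult norm_power)
      finally show False
        by simp
    qed
  qed
qed

section \<open>The cubic form without lines\<close>

definition norm_mpoly :: "int \<Rightarrow> 'n \<Rightarrow> 'n \<Rightarrow> 'n \<Rightarrow> ('n::finite, int) mpoly" where
  "norm_mpoly t i j k = cubic_mono t i i i + cubic_mono (7 * t) j j j + cubic_mono (49 * t) k k k
     + cubic_mono (2 * t) i i k + cubic_mono t i k k + cubic_mono (- t) i j j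
     + cubic_mono (- 7 * t) j k k + cubic_mono (- 21 * t) i j k"

lemma form_norm_mpoly: "form 3 (norm_mpoly t i j k)"
  unfolding norm_mpoly_def by (intro form_add form_cubic_mono)

lemma eval_norm_mpoly:
  "eval_int_mpoly (norm_mpoly t i j k) v = of_int t * cubic_norm (v $ i) (v $ j) (v $ k)"
  by (simp add: norm_mpoly_def eval_int_mpoly_add eval_cubic_mono cubic_norm_def
      algebra_simps power2_eq_square power3_eq_cube)

text \<open>Everything except the diagonal part. The weights 1, p, p^2 allow the norm blocks to be
  treated one power of p at a time.\<close>

definition layered_form :: "int \<Rightarrow> (11, int) mpoly" where
  "layered_form p = cubic_mono 1 0 4 4 + norm_mpoly 1 1 2 3 + norm_mpoly p 5 6 7
     + norm_mpoly (p ^ 2) 8 9 10"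

lemma form_layered_form: "form 3 (layered_form p)"
  unfolding layered_form_def by (intro form_add form_norm_mpoly form_cubic_mono)

lemma eval_layered_form:
  "eval_int_mpoly (layered_form p) v = v $ 0 * v $ 4 ^ 2 + cubic_norm (v $ 1) (v $ 2) (v $ 3)
     + of_int p * cubic_norm (v $ 5) (v $ 6) (v $ 7) + of_int p ^ 2 * cubic_norm (v $ 8) (v $ 9) (v $ 10)"
  by (simp add: layered_form_def eval_int_mpoly_add eval_norm_mpoly eval_cubic_mono power2_eq_square)

lemma all_11: "(\<forall>i::11. P i) \<longleftrightarrow>
  P 0 \<and> P 1 \<and> P 2 \<and> P 3 \<and> P 4 \<and> P 5 \<and> P 6 \<and> P 7 \<and> P 8 \<and> P 9 \<and> P 10"
proof (intro iffI allI)
  fix i :: 11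
  assume P: "P 0 \<and> P 1 \<and> P 2 \<and> P 3 \<and> P 4 \<and> P 5 \<and> P 6 \<and> P 7 \<and> P 8 \<and> P 9 \<and> P 10"
  obtain k where "i = of_int k" "0 \<le> k" "k < 11"
    by (cases i) auto
  moreover from this have "k \<in> {0, 1, 2, 3, 4, 5, 6, 7, 8, 9, 10}"
    unfolding insert_iff empty_iff by presburger
  ultimately show "P i"
    using P by auto
qed auto

text \<open>Reads an equation modulo p, discarding the integral multiple of p.\<close>

lemma padic_small_of_add_eq_0:
  fixes a b :: "'p::prime_card padic"
  assumes "a + of_nat CARD('p) * b = 0" "padic_integral b"
  shows "padic_small a"
proof -
  have "a = of_nat CARD('p) * (- b)"
    using assms(1) by (simp only: mult_minus_right eq_neg_iff_add_eq_0)
  then show ?thesis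
    using padic_integral_minus[OF assms(2)] by (simp only: padic_small_prime_mult)
qed

section \<open>Integral p-adic zeros of the form, modulo p\<close>

context
  fixes z :: "'p::prime_card padic ^ 11" and K :: int
  assumes p: "CARD('p) \<in> {2, 3, 5}"
    and int: "\<And>i. padic_integral (z $ i)"
    and zero: "eval_int_mpoly (layered_form (int CARD('p)) + fermat_cubic (int CARD('p) ^ 3 * K)) z = 0"
begin

abbreviation (input) prime_elt :: "'p padic" where "prime_elt \<equiv> of_nat CARD('p)"

lemma layered_zero:
  "z $ 0 * z $ 4 ^ 2 + cubic_norm (z $ 1) (z $ 2) (z $ 3)
   + prime_elt * cubic_norm (z $ 5) (z $ 6) (z $ 7) + prime_elt ^ 2 * cubic_norm (z $ 8) (z $ 9) (z $ 10)
   + prime_elt ^ 3 * (of_int K * (\<Sum>i\<in>UNIV. z $ i ^ 3)) = 0"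
  using zero by (simp add: eval_int_mpoly_add eval_layered_form eval_fermat_cubic mult.assoc)

text \<open>All other terms of the form carry a factor p.\<close>

lemma layered_zero_mod:
  "padic_small (z $ 0 * z $ 4 ^ 2 + cubic_norm (z $ 1) (z $ 2) (z $ 3))"
proof (rule padic_small_of_add_eq_0)
  show "z $ 0 * z $ 4 ^ 2 + cubic_norm (z $ 1) (z $ 2) (z $ 3)
      + prime_elt * (cubic_norm (z $ 5) (z $ 6) (z $ 7) + prime_elt * cubic_norm (z $ 8) (z $ 9) (z $ 10)
        + prime_elt ^ 2 * (of_int K * (\<Sum>i\<in>UNIV. z $ i ^ 3))) = 0"
    using layered_zero by (simp add: algebra_simps power2_eq_square power3_eq_cube)
qed (intro padic_integral_intros padic_integral_cubic_norm int)

text \<open>Once the first five coordinates are divisible by \<open>p\<close>, their contribution and that of the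
  diagonal part are divisible by \<open>p\<^sup>3\<close>, so the remaining two norms are forced to vanish modulo
  \<open>p\<close> one after the other.\<close>

lemma layered_zero_all_small:
  assumes "padic_small (z $ 0)" "padic_small (z $ 1)" "padic_small (z $ 2)" "padic_small (z $ 3)"
    "padic_small (z $ 4)"
  shows "padic_small (z $ i)"
proof -
  obtain u0 u1 u2 u3 u4 where
    u: "z $ 0 = prime_elt * u0" "z $ 1 = prime_elt * u1" "z $ 2 = prime_elt * u2"
       "z $ 3 = prime_elt * u3" "z $ 4 = prime_elt * u4"
    and iu: "padic_integral u0" "padic_integral u1" "padic_integral u2" "padic_integral u3" "padic_integral u4"
    using assms by (metis padic_smallE)
  \<comment> \<open>The cofactor of p^3: with the first five coordinates divisible by p, both x_0
    x_4^2 and the first norm contribute p^3 times an integral value, and the diagonal part has the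
    factor p^3 already.\<close>
  define S where "S = u0 * u4 ^ 2 + cubic_norm u1 u2 u3 + of_int K * (\<Sum>i\<in>UNIV. z $ i ^ 3)"
  have S: "padic_integral S"
    unfolding S_def by (intro padic_integral_intros padic_integral_cubic_norm int iu)
  have "prime_elt * (cubic_norm (z $ 5) (z $ 6) (z $ 7)
      + prime_elt * (cubic_norm (z $ 8) (z $ 9) (z $ 10) + prime_elt * S)) = 0"
    using layered_zero unfolding u cubic_norm_scale S_def
    by (simp add: algebra_simps power2_eq_square power3_eq_cube)
  then have eq: "cubic_norm (z $ 5) (z $ 6) (z $ 7)
      + prime_elt * (cubic_norm (z $ 8) (z $ 9) (z $ 10) + prime_elt * S) = 0"
    by simp
  then have "padic_small (cubic_norm (z $ 5) (z $ 6) (z $ 7))"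
    by (rule padic_small_of_add_eq_0)
      (intro padic_integral_intros padic_integral_cubic_norm int S)
  then have s567: "padic_small (z $ 5) \<and> padic_small (z $ 6) \<and> padic_small (z $ 7)"
    by (intro padic_small_cubic_normD p int)
  then obtain v5 v6 v7 where
    v: "z $ 5 = prime_elt * v5" "z $ 6 = prime_elt * v6" "z $ 7 = prime_elt * v7"
    and iv: "padic_integral v5" "padic_integral v6" "padic_integral v7"
    by (metis padic_smallE)
  \<comment> \<open>The norm of the coordinates 5, 6, 7 is now p^3 times an integral norm, so
    another factor p can be cancelled.\<close>
  have "prime_elt * (cubic_norm (z $ 8) (z $ 9) (z $ 10)
      + prime_elt * (S + prime_elt * cubic_norm v5 v6 v7)) = 0"
    using eq unfolding v cubic_norm_scale by (simp add: algebra_simps power3_eq_cube)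
  then have "cubic_norm (z $ 8) (z $ 9) (z $ 10) + prime_elt * (S + prime_elt * cubic_norm v5 v6 v7) = 0"
    by simp
  then have "padic_small (cubic_norm (z $ 8) (z $ 9) (z $ 10))"
    by (rule padic_small_of_add_eq_0)
      (intro padic_integral_intros padic_integral_cubic_norm int S iv)
  then have "padic_small (z $ 8) \<and> padic_small (z $ 9) \<and> padic_small (z $ 10)"
    by (intro padic_small_cubic_normD p int)
  then have "\<forall>i. padic_small (z $ i)"
    unfolding all_11 using assms s567 by blast
  then show ?thesis ..
qed

end

lemma layered_form_contains_no_line:
  assumes p: "CARD('p::prime_card) \<in> {2, 3, 5}"
  shows "\<not> contains_line_over TYPE('p padic)
    (layered_form (int CARD('p)) + fermat_cubic (int CARD('p) ^ 3 * K))"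
    (is "\<not> contains_line_over _ ?F")
proof
  assume "contains_line_over TYPE('p padic) ?F"
  then obtain x y :: "'p padic ^ 11" where
    indep: "\<And>a b. a *s x + b *s y = 0 \<Longrightarrow> a = 0 \<and> b = 0"
    and line: "\<And>a b. eval_int_mpoly ?F (a *s x + b *s y) = 0"
    unfolding contains_line_over_def by blast
  \<comment> \<open>A single linear condition on the two-dimensional span leaves a nonzero vector,
    which is then scaled to be primitive.\<close>
  have primitive: "\<exists>a b. let z = a *s x + b *s y in z $ i = 0 \<and> (\<forall>j. padic_integral (z $ j))
      \<and> (\<exists>j. \<not> padic_small (z $ j))" for i
  proof -
    obtain a b where ab: "a \<noteq> 0 \<or> b \<noteq> 0" "a * x $ i + b * y $ i = 0"
    proof (cases "x $ i = 0 \<and> y $ i = 0")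
      case True
      then show ?thesis
        using that[of 1 0] by simp
    next
      case False
      then show ?thesis
        \<comment> \<open>These coefficients solve a x_i + b y_i = 0 and are not both zero in this
          case.\<close>
        using that[of "y $ i" "- x $ i"] by auto
    qed
    then have "a *s x + b *s y \<noteq> 0"
      using indep by blast
    then obtain c where "c \<noteq> 0" "\<And>j. padic_integral ((c *s (a *s x + b *s y)) $ j)"
        "\<exists>j. \<not> padic_small ((c *s (a *s x + b *s y)) $ j)"
      by (rule padic_primitive_multiple) (rule that)
    moreover have "c *s (a *s x + b *s y) = (c * a) *s x + (c * b) *s y"
      by (simp add: vector_add_ldistrib)
    moreover have "(c *s (a *s x + b *s y)) $ i = 0"
      by (simp only: vector_smult_component vector_add_component ab(2) mult_zero_right)
    ultimately show ?thesis
      unfolding Let_def by metis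
  qed
  \<comment> \<open>Vanishing of coordinate 4, or of coordinate 0 for w, removes the term x_0 x_4^2
    and leaves the first norm alone modulo p.\<close>
  obtain a b v where v_def: "v = a *s x + b *s y" and v4: "v $ 4 = 0"
    and iv: "\<And>j. padic_integral (v $ j)" and pv: "\<exists>j. \<not> padic_small (v $ j)"
    using primitive[of 4] unfolding Let_def by blast
  obtain c d w where w_def: "w = c *s x + d *s y" and w0: "w $ 0 = 0"
    and iw: "\<And>j. padic_integral (w $ j)" and pw: "\<exists>j. \<not> padic_small (w $ j)"
    using primitive[of 0] unfolding Let_def by blast
  have zv: "eval_int_mpoly ?F v = 0" and zw: "eval_int_mpoly ?F w = 0"
    unfolding v_def w_def by (rule line)+
  have "v + w = (a + c) *s x + (b + d) *s y"
    by (simp add: v_def w_def vec_eq_iff algebra_simps)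
  then have zvw: "eval_int_mpoly ?F (v + w) = 0"
    by (simp only: line)
  have ivw: "padic_integral ((v + w) $ j)" for j
    using iv iw by (simp add: padic_integral_add)
  have "padic_small (cubic_norm (v $ 1) (v $ 2) (v $ 3))"
    using layered_zero_mod[OF p iv zv] v4 by simp
  then have sv: "padic_small (v $ 1) \<and> padic_small (v $ 2) \<and> padic_small (v $ 3)"
    by (intro padic_small_cubic_normD p iv)
  \<comment> \<open>The coordinates 1 to 4 are small, so a small coordinate 0 would make all of v
    small, against primitivity.\<close>
  then have v0: "\<not> padic_small (v $ 0)"
    using layered_zero_all_small[OF p iv zv] v4 pv by auto
  have "padic_small (cubic_norm (w $ 1) (w $ 2) (w $ 3))"
    using layered_zero_mod[OF p iw zw] w0 by simp
  then have sw: "padic_small (w $ 1) \<and> padic_small (w $ 2) \<and> padic_small (w $ 3)"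
    by (intro padic_small_cubic_normD p iw)
  then have w4: "\<not> padic_small (w $ 4)"
    using layered_zero_all_small[OF p iw zw] w0 pw by auto
  have "padic_small ((v + w) $ 1)" "padic_small ((v + w) $ 2)" "padic_small ((v + w) $ 3)"
    using sv sw by (simp_all add: padic_small_add)
  then have "padic_small (cubic_norm ((v + w) $ 1) ((v + w) $ 2) ((v + w) $ 3))"
    by (rule padic_small_cubic_norm)
  \<comment> \<open>Coordinate 0 of v + w comes from v and coordinate 4 from w, so x_0 x_4^2 takes
    this value at v + w.\<close>
  then have "padic_small (v $ 0 * w $ 4 ^ 2)"
    using padic_small_diff[OF layered_zero_mod[OF p ivw zvw]] v4 w0 by fastforce
  then show False
    using v0 w4 iv iw by (metis padic_small_multD padic_integral_power power2_eq_square)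
qed

theorem theorem1p4:
  assumes "CARD('p::prime_card) \<in> {2, 3, 5}"
  shows "\<exists>F :: (11, int) mpoly. form 3 F \<and> smooth_over_complex F
           \<and> \<not> contains_line_over TYPE('p padic) F"
proof -
  let ?p = "int CARD('p)"
  obtain K0 where K0: "\<And>K. K \<ge> K0 \<Longrightarrow> smooth_over_complex (layered_form ?p + fermat_cubic K)"
    using smooth_add_fermat_cubic[OF form_layered_form] by blast
  \<comment> \<open>The absolute value covers a negative threshold; the diagonal coefficient must be
    both at least \<open>K0\<close> and divisible by p^3.\<close>
  have "1 * \<bar>K0\<bar> \<le> ?p ^ 3 * \<bar>K0\<bar>"
    using assms by (intro mult_right_mono) auto
  then have "smooth_over_complex (layered_form ?p + fermat_cubic (?p ^ 3 * \<bar>K0\<bar>))"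
    by (intro K0) simp
  then show ?thesis
    using layered_form_contains_no_line[OF assms] form_add[OF form_layered_form form_fermat_cubic] by blast
qed

end
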